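(* Let $S\ge1$, $L\ge 2$ and $N\ge0$ be integers and suppose that the tower state $|SS_{2N}\rangle=(\hat{\mathcal O}_{SS_2})^N|SG\rangle$ of the spin-$S$ AKLT chain with $L$ sites and open boundary conditions (both edge spins in their highest-weight state) is nonzero. Then for every bipartition of the chain into two nonempty contiguous regions $\mathcal A=\{1,\dots,\ell\}$ and $\mathcal B=\{\ell+1,\dots,L\}$, the von Neumann entanglement entropy $\mathcal S=-\mathrm{Tr}(\rho_{\mathcal A}\log\rho_{\mathcal A})$ of the normalized reduced density matrix $\rho_{\mathcal A}$ of $|SS_{2N}\rangle$ satisfies $$\mathcal S\le\log\left[(S+1)(N+1)\right].$$
   Context: Let $S\ge1$ be an integer. Each site of a chain of $L$ sites carries a spin-$S$ with orthonormal basis $|m\rangle$, $m\in\{-S,\dots,S\}$ ($S^z$ eigenbasis), and $S_j^+$ denotes the spin raising operator on site $j$. Spin-$S$ AKLT ground state: let $I=\{-S/2,-S/2+1,\dots,S/2\}$. For $u,v\in I$ define, using Clebsch-Gordan coefficients (standard phase convention) for coupling two spins $S/2$, $$M^{[m]}_{uv}=\langle S,m\,|\,\tfrac S2,u;\tfrac S2,v\rangle \ (\text{zero unless } m=u+v),\qquad \Theta_{uv}=\langle \tfrac S2,u;\tfrac S2,v\,|\,0,0\rangle\ (\text{zero unless }u=-v),$$ and the $(S+1)\times(S+1)$ matrices $A^{[m]}=M^{[m]}\Theta$. The ground state of the open chain with both free edge spin-$S/2$'s having $S^z=+S/2$ is, up to normalization, $$|SG\rangle=\sum_{m_1,\dots,m_L}\left(A^{[m_1]}A^{[m_2]}\cdots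 A^{[m_L]}\right)_{S/2,\,-S/2}|m_1m_2\cdots m_L\rangle .$$ The tower of states is $|SS_{2N}\rangle=(\hat{\mathcal O}_{SS_2})^N|SG\rangle$ with $\hat{\mathcal O}_{SS_2}=\sum_{j=1}^{L}(-1)^j(S_j^+)^{2S}$. For a nonzero vector $|\psi\rangle$, $\rho_{\mathcal A}=\mathrm{Tr}_{\mathcal B}|\psi\rangle\langle\psi|/\langle\psi|\psi\rangle$. Logarithms are natural. *)

theory Defs
  imports "Jordan_Normal_Form.Schur_Decomposition"
begin

section \<open>Clebsch-Gordan coefficients\<close>

text \<open>The arguments below are integers for all admissible quantum numbers.\<close>

definition rfact :: "real \<Rightarrow> real" where
  "rfact x = fact (nat \<lfloor>x\<rfloor>)"

text \<open>
  \<open>clebsch_gordan j1 m1 j2 m2 J M\<close> is the coefficient \<open>\<langle>j1,m1;j2,m2|J,M\<rangle>\<close>, given by Racah's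
  closed formula, in the Condon-Shortley phase convention (so it is real and equals
  \<open>\<langle>J,M|j1,m1;j2,m2\<rangle>\<close>). The sum over \<open>k\<close> runs over the naturals for which every
  factorial has a nonnegative argument. The quantum numbers \<open>(j,m)\<close> passed to it are assumed to be
  half-integers with \<open>j - m\<close> an integer.
\<close>

definition clebsch_gordan :: "real \<Rightarrow> real \<Rightarrow> real \<Rightarrow> real \<Rightarrow> real \<Rightarrow> real \<Rightarrow> real" where
  "clebsch_gordan j1 m1 j2 m2 J M =
    (if M = m1 + m2 \<and> \<bar>m1\<bar> \<le> j1 \<and> \<bar>m2\<bar> \<le> j2 \<and> \<bar>M\<bar> \<le> J \<and> \<bar>j1 - j2\<bar> \<le> J \<and> J \<le> j1 + j2
     then
       sqrt ((2 * J + 1) * rfact (J + j1 - j2) * rfact (J - j1 + j2) * rfact (j1 + j2 - J)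
             / rfact (j1 + j2 + J + 1))
       * sqrt (rfact (J + M) * rfact (J - M) * rfact (j1 - m1) * rfact (j1 + m1)
               * rfact (j2 - m2) * rfact (j2 + m2))
       * (\<Sum>k \<in> {k :: nat. real k \<le> j1 + j2 - J \<and> real k \<le> j1 - m1 \<and> real k \<le> j2 + m2
                         \<and> 0 \<le> J - j2 + m1 + real k \<and> 0 \<le> J - j1 - m2 + real k}.
            (- 1) ^ k / (fact k * rfact (j1 + j2 - J - real k) * rfact (j1 - m1 - real k)
                         * rfact (j2 + m2 - real k) * rfact (J - j2 + m1 + real k)
                         * rfact (J - j1 - m2 + real k)))
     else 0)"

section \<open>States of the chain\<close>

text \<open>
  A basis configuration \<open>|m\<^sub>1 \<dots> m\<^sub>L\<rangle>\<close> is a list of length \<open>L\<close>; site \<open>j\<close> is list position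
  \<open>j - 1\<close>. A state is its amplitude function; for a chain of \<open>L\<close> sites only its values on
  \<open>configs S L\<close> are meaningful.
\<close>

type_synonym state = "int list \<Rightarrow> complex"

definition config_list :: "nat \<Rightarrow> nat \<Rightarrow> int list list" where
  "config_list S L = List.n_lists L [- int S..int S]"

definition configs :: "nat \<Rightarrow> nat \<Rightarrow> int list set" where
  "configs S L = {ms. length ms = L \<and> set ms \<subseteq> {- int S..int S}}"

lemma set_config_list: "set (config_list S L) = configs S L"
  by (auto simp: config_list_def configs_def set_n_lists)

lemma distinct_config_list: "distinct (config_list S L)"
  by (simp add: config_list_def distinct_n_lists)

subsection \<open>The AKLT ground state\<close>

text \<open>Row and column index \<open>i \<in> {0..S}\<close> stands for the bond spin projection \<open>u = i - S/2\<close>.\<close>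

definition bond_spin :: "nat \<Rightarrow> nat \<Rightarrow> real" where
  "bond_spin S i = real i - real S / 2"

definition aklt_M :: "nat \<Rightarrow> int \<Rightarrow> complex mat" where
  "aklt_M S m = mat (S + 1) (S + 1) (\<lambda>(i, j). complex_of_real
     (clebsch_gordan (real S / 2) (bond_spin S i) (real S / 2) (bond_spin S j) (real S) (of_int m)))"

definition aklt_Theta :: "nat \<Rightarrow> complex mat" where
  "aklt_Theta S = mat (S + 1) (S + 1) (\<lambda>(i, j). complex_of_real
     (clebsch_gordan (real S / 2) (bond_spin S i) (real S / 2) (bond_spin S j) 0 0))"

definition aklt_A :: "nat \<Rightarrow> int \<Rightarrow> complex mat" where
  "aklt_A S m = aklt_M S m * aklt_Theta S"

text \<open>The entry in row \<open>S/2\<close> and column \<open>-S/2\<close> has matrix position \<open>(S, 0)\<close>.\<close>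

definition aklt_ground :: "nat \<Rightarrow> state" where
  "aklt_ground S ms = foldr (\<lambda>m X. aklt_A S m * X) ms (1\<^sub>m (S + 1)) $$ (S, 0)"

subsection \<open>The tower of states\<close>

text \<open>
  \<open>S\<^sup>+|m\<rangle> = sqrt (S (S + 1) - m (m + 1)) |m + 1\<rangle>\<close>, written on amplitudes. The prefactor vanishes for
  \<open>m\<^sub>j = -S\<close>, so the amplitude of a nonexistent level \<open>-S - 1\<close> never contributes.
\<close>

definition spin_raise :: "nat \<Rightarrow> nat \<Rightarrow> state \<Rightarrow> state" where
  "spin_raise S j \<psi> = (\<lambda>ms. let m = ms ! (j - 1) in
     complex_of_real (sqrt (real S * (real S + 1) - of_int (m - 1) * of_int m))
       * \<psi> (ms[j - 1 := m - 1]))"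

definition tower_op :: "nat \<Rightarrow> nat \<Rightarrow> state \<Rightarrow> state" where
  "tower_op S L \<psi> = (\<lambda>ms. \<Sum>j = 1..L. (- 1) ^ j * (spin_raise S j ^^ (2 * S)) \<psi> ms)"

definition tower_state :: "nat \<Rightarrow> nat \<Rightarrow> nat \<Rightarrow> state" where
  "tower_state S L N = (tower_op S L ^^ N) (aklt_ground S)"

section \<open>Entanglement entropy\<close>

definition norm_sq :: "nat \<Rightarrow> nat \<Rightarrow> state \<Rightarrow> real" where
  "norm_sq S L \<psi> = (\<Sum>ms \<in> configs S L. (cmod (\<psi> ms))\<^sup>2)"

text \<open>
  Normalized reduced density matrix of the first \<open>l\<close> sites of a chain of \<open>L\<close> sites, in the basis
  enumerated by \<open>config_list S l\<close>.
\<close>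

definition reduced_density :: "nat \<Rightarrow> nat \<Rightarrow> nat \<Rightarrow> state \<Rightarrow> complex mat" where
  "reduced_density S L l \<psi> =
    (let cs = config_list S l; n = length cs in
     mat n n (\<lambda>(a, b).
       (\<Sum>ms \<in> configs S (L - l). \<psi> (cs ! a @ ms) * cnj (\<psi> (cs ! b @ ms)))
         / complex_of_real (norm_sq S L \<psi>)))"

definition mat_trace :: "'a :: comm_monoid_add mat \<Rightarrow> 'a" where
  "mat_trace A = sum_list (diag_mat A)"

text \<open>
  Functional calculus for Hermitian matrices: if \<open>A = U diag(d) U\<^sup>*\<close> with \<open>U\<close> unitary and \<open>d\<close> real,
  then \<open>f(A) = U diag(f \<circ> d) U\<^sup>*\<close>, which does not depend on the choice of \<open>U\<close> and \<open>d\<close>.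
\<close>

definition hermitian_fun :: "(real \<Rightarrow> real) \<Rightarrow> complex mat \<Rightarrow> complex mat" where
  "hermitian_fun f A = (SOME B. \<exists>U (d :: nat \<Rightarrow> real).
     U \<in> carrier_mat (dim_row A) (dim_row A) \<and>
     U * mat_adjoint U = 1\<^sub>m (dim_row A) \<and>
     A = U * mat_diag (dim_row A) (\<lambda>i. complex_of_real (d i)) * mat_adjoint U \<and>
     B = U * mat_diag (dim_row A) (\<lambda>i. complex_of_real (f (d i))) * mat_adjoint U)"

text \<open>
  Since \<open>ln 0 = 0\<close>, the kernel of \<open>\<rho>\<close> contributes nothing, which is the usual convention
  \<open>0 log 0 = 0\<close>. The trace is real; \<open>Re\<close> only changes its type.
\<close>

definition von_neumann_entropy :: "complex mat \<Rightarrow> real" where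
  "von_neumann_entropy \<rho> = - Re (mat_trace (\<rho> * hermitian_fun ln \<rho>))"

end

(* Cutting the bond between sites l and l + 1 splits the matrix product ground state into S + 1
   product terms and the tower operator into O_A + (-1)^l O_B, two commuting halves. Hence the N-th
   tower state is a combination of products whose left factors are among the (S + 1)(N + 1) vectors
   O_A^k X_i with k <= N and i <= S. Its Schmidt rank, i.e. the number of nonzero eigenvalues of the
   reduced density matrix, is therefore at most (S + 1)(N + 1), and a probability vector with at most
   r nonzero entries has entropy at most log r. *)

theory Submission
  imports Defs "Jordan_Normal_Form.Spectral_Radius"
begin

section \<open>Hermitian matrices and entropy\<close>

lemma mat_adjoint_eq:
  "mat_adjoint (A :: complex mat) = mat (dim_col A) (dim_row A) (\<lambda>(i, j). cnj (A $$ (j, i)))"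
  by (rule eq_matI) (auto simp: mat_adjoint_def mat_of_rows_def)

lemma mat_adjoint_carrier [simp]:
  "A \<in> carrier_mat n m \<Longrightarrow> mat_adjoint (A :: complex mat) \<in> carrier_mat m n"
  by (auto simp: mat_adjoint_eq)

lemma mat_adjoint_mult:
  fixes A B :: "complex mat"
  assumes "A \<in> carrier_mat n m" "B \<in> carrier_mat m k"
  shows "mat_adjoint (A * B) = mat_adjoint B * mat_adjoint A"
  using assms by (intro eq_matI) (auto simp: mat_adjoint_eq scalar_prod_def mult.commute)

lemma mat_adjoint_mat_adjoint [simp]: "mat_adjoint (mat_adjoint A) = (A :: complex mat)"
  by (intro eq_matI) (auto simp: mat_adjoint_eq)

lemma mat_adjoint_one [simp]: "mat_adjoint (1\<^sub>m n) = (1\<^sub>m n :: complex mat)"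
  by (intro eq_matI) (auto simp: mat_adjoint_eq)

lemma mat_adjoint_four_block_diag:
  fixes A B :: "complex mat"
  assumes "A \<in> carrier_mat n n" "B \<in> carrier_mat m m"
  shows "mat_adjoint (four_block_mat A (0\<^sub>m n m) (0\<^sub>m m n) B)
    = four_block_mat (mat_adjoint A) (0\<^sub>m n m) (0\<^sub>m m n) (mat_adjoint B)"
  using assms by (intro eq_matI) (auto simp: mat_adjoint_eq)

section \<open>Unitary diagonalization of Hermitian matrices\<close>

text \<open>Complete \<open>v\<close> to a basis that starts with \<open>v\<close>, orthogonalize it
  by Gram-Schmidt, which leaves the first vector unchanged, and normalize. The scalar
  \<open>c\<close> absorbs the normalization of \<open>v\<close>.\<close>

lemma unitary_with_first_column:
  fixes v :: "complex vec"
  assumes v: "v \<in> carrier_vec n" and v0: "v \<noteq> 0\<^sub>v n"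
  obtains W c where "W \<in> carrier_mat n n" "mat_adjoint W * W = 1\<^sub>m n" "col W 0 = c \<cdot>\<^sub>v v"
proof -
  interpret cof_vec_space n "TYPE(complex)" .
  define b where "b = basis_completion v"
  define ws where "ws = gram_schmidt n b"
  note bc = basis_completion[OF v v0, folded b_def]
  have n: "n > 0" using v v0 by (cases n) auto
  have hdb: "hd b = v"
    using v0 by (simp add: b_def basis_completion_def Let_def)
  then obtain vs where bv: "b = v # vs" using bc(6) n by (cases b) auto
  have ws: "set ws \<subseteq> carrier_vec n" "corthogonal ws" "length ws = n"
    using gram_schmidt_result[OF bc(2) bc(4) bc(5) ws_def] bc(6) by auto
  have ws0: "ws ! 0 = v"
    using gram_schmidt_hd[OF v, of vs, folded bv, folded ws_def] ws(3) n
    by (cases ws) auto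
  \<comment> \<open>\<open>corthogonal\<close> gives orthogonality without unit length, so the
    columns of \<open>W\<close> are divided by these norms. The self inner product is a complex
    number, hence the \<open>Re\<close>.\<close>
  define s where "s j = sqrt (Re (ws ! j \<bullet>c ws ! j))" for j
  have wsc: "ws ! j \<in> carrier_vec n" if "j < n" for j
    using that ws by auto
  have s: "ws ! j \<bullet>c ws ! j = complex_of_real (s j) * complex_of_real (s j)" "s j \<noteq> 0"
    if j: "j < n" for j
  proof -
    have nz: "ws ! j \<bullet>c ws ! j \<noteq> 0" using corthogonalD[OF ws(2), of j j] ws(3) j by auto
    have ge: "ws ! j \<bullet>c ws ! j \<ge> 0" using wsc[OF j] by auto
    then have im: "Im (ws ! j \<bullet>c ws ! j) = 0" and re: "Re (ws ! j \<bullet>c ws ! j) \<ge> 0"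
      by (auto simp: less_eq_complex_def)
    show "ws ! j \<bullet>c ws ! j = complex_of_real (s j) * complex_of_real (s j)"
      using im re by (intro complex_eqI) (auto simp: s_def)
    show "s j \<noteq> 0" using nz im re by (auto simp: s_def complex_eq_iff)
  qed
  define W where "W = mat n n (\<lambda>(i, j). ws ! j $ i / complex_of_real (s j))"
  have W: "W \<in> carrier_mat n n" by (simp add: W_def)
  have "mat_adjoint W * W = 1\<^sub>m n"
  proof (rule eq_matI)
    fix i j assume "i < dim_row (1\<^sub>m n :: complex mat)" "j < dim_col (1\<^sub>m n :: complex mat)"
    then have i: "i < n" and j: "j < n" by auto
    have "(mat_adjoint W * W) $$ (i, j)
      = (\<Sum>k = 0..<n. cnj (ws ! i $ k / complex_of_real (s i)) * (ws ! j $ k / complex_of_real (s j)))"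
      using i j by (simp add: mat_adjoint_eq W_def scalar_prod_def)
    also have "\<dots> = (\<Sum>k = 0..<n. ws ! j $ k * cnj (ws ! i $ k))
        / (complex_of_real (s i) * complex_of_real (s j))"
      by (simp add: sum_divide_distrib mult.commute)
    also have "(\<Sum>k = 0..<n. ws ! j $ k * cnj (ws ! i $ k)) = ws ! j \<bullet>c ws ! i"
      using wsc[OF i] by (simp add: scalar_prod_def)
    also have "\<dots> / (complex_of_real (s i) * complex_of_real (s j)) = (if i = j then 1 else 0)"
      using s[OF i] corthogonalD[OF ws(2), of j i] ws(3) i j by auto
    finally show "(mat_adjoint W * W) $$ (i, j) = 1\<^sub>m n $$ (i, j)" using i j by simp
  qed (auto simp: mat_adjoint_eq W_def)
  moreover have "col W 0 = (1 / complex_of_real (s 0)) \<cdot>\<^sub>v v"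
    using n ws0 v by (intro eq_vecI) (auto simp: W_def)
  ultimately show ?thesis using that W by blast
qed

text \<open>Induction on the dimension. Moving an eigenvector to the first coordinate splits off a
  block of size one, and the remaining block is again Hermitian. The result supplies a witness for
  the choice in \<open>hermitian_fun\<close>.\<close>

lemma hermitian_spectral_decomposition:
  fixes A :: "complex mat"
  assumes "A \<in> carrier_mat n n" "mat_adjoint A = A"
  shows "\<exists>U (d :: nat \<Rightarrow> real). U \<in> carrier_mat n n \<and> U * mat_adjoint U = 1\<^sub>m n \<and>
    A = U * mat_diag n (\<lambda>i. complex_of_real (d i)) * mat_adjoint U"
  using assms
proof (induction n arbitrary: A)
  case 0
  then show ?case
    by (intro exI[of _ "1\<^sub>m 0"] exI[of _ "\<lambda>_. 0"]) (auto intro!: eq_matI simp: mat_adjoint_eq)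
next
  case (Suc n)
  let ?N = "Suc n"
  note A = Suc.prems(1)
  obtain e v where "eigenvector A v e"
    using spectrum_non_empty[OF A] unfolding spectrum_def eigenvalue_def by auto
  then have v: "v \<in> carrier_vec ?N" "v \<noteq> 0\<^sub>v ?N" and Av: "A *\<^sub>v v = e \<cdot>\<^sub>v v"
    using A by (auto simp: eigenvector_def)
  obtain W c where W: "W \<in> carrier_mat ?N ?N" and WW: "mat_adjoint W * W = 1\<^sub>m ?N"
    and W0: "col W 0 = c \<cdot>\<^sub>v v" using unitary_with_first_column[OF v] by blast
  note W' = mat_adjoint_carrier[OF W]
  have WW': "W * mat_adjoint W = 1\<^sub>m ?N" using mat_mult_left_right_inverse[OF W' W WW] .
  \<comment> \<open>\<open>C\<close> is \<open>A\<close> written in the orthonormal basis of the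
    columns of \<open>W\<close>. As column 0 of \<open>W\<close> is an eigenvector, column 0 of
    \<open>C\<close> is \<open>e\<close> times the first unit vector.\<close>
  define C where "C = mat_adjoint W * (A * W)"
  have C: "C \<in> carrier_mat ?N ?N" unfolding C_def using A W W' by (intro mult_carrier_mat)
  have "mat_adjoint C = mat_adjoint (A * W) * mat_adjoint (mat_adjoint W)"
    unfolding C_def by (rule mat_adjoint_mult[OF W' mult_carrier_mat[OF A W]])
  also have "\<dots> = mat_adjoint W * A * W"
    by (simp only: mat_adjoint_mult[OF A W] Suc.prems(2) mat_adjoint_mat_adjoint)
  also have "\<dots> = C" unfolding C_def by (rule assoc_mult_mat[OF W' A W])
  finally have C_adj: "mat_adjoint C = C" .
  have W0_car: "col W 0 \<in> carrier_vec ?N" using W v(1) by (simp add: W0)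
  have Ae: "A *\<^sub>v col W 0 = e \<cdot>\<^sub>v col W 0"
    unfolding W0 mult_mat_vec[OF A v(1)] Av by (simp add: smult_smult_assoc mult.commute)
  have "col C 0 = mat_adjoint W *\<^sub>v (A *\<^sub>v col W 0)"
    unfolding C_def by (simp only: col_mult2[OF W' mult_carrier_mat[OF A W]] col_mult2[OF A W] zero_less_Suc)
  also have "\<dots> = e \<cdot>\<^sub>v (mat_adjoint W *\<^sub>v col W 0)"
    unfolding Ae by (rule mult_mat_vec[OF W' W0_car])
  also have "mat_adjoint W *\<^sub>v col W 0 = col (mat_adjoint W * W) 0"
    using col_mult2[OF W' W, of 0] by simp
  finally have C0: "col C 0 = e \<cdot>\<^sub>v unit_vec ?N 0" using WW by simp
  have Ci0: "C $$ (i, 0) = (if i = 0 then e else 0)" if "i < ?N" for i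
    using arg_cong[OF C0, of "\<lambda>x. x $ i"] that C by auto
  have C_cnj: "cnj (C $$ (j, i)) = C $$ (i, j)" if "i < ?N" "j < ?N" for i j
    using arg_cong[OF C_adj, of "\<lambda>X. X $$ (i, j)"] that C by (simp add: mat_adjoint_eq)
  \<comment> \<open>Hermitian symmetry carries the zeros of column 0 over to row 0 and, at the
    corner, forces \<open>e\<close> to be real.\<close>
  have C0i: "C $$ (0, i) = (if i = 0 then e else 0)" if "i < ?N" for i
    using C_cnj[of 0 i] Ci0[of i] C_cnj[of 0 0] Ci0[of 0] that by (auto split: if_splits)
  have e: "complex_of_real (Re e) = e"
    using C_cnj[of 0 0] Ci0[of 0] by (simp add: complex_eq_iff)
  define B where "B = mat n n (\<lambda>(i, j). C $$ (Suc i, Suc j))"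
  have B: "B \<in> carrier_mat n n" by (simp add: B_def)
  have "mat_adjoint B = B"
    by (intro eq_matI) (auto simp: mat_adjoint_eq B_def C_cnj)
  from Suc.IH[OF B this] obtain V d where V: "V \<in> carrier_mat n n"
    and VV: "V * mat_adjoint V = 1\<^sub>m n"
    and BV: "B = V * mat_diag n (\<lambda>i. complex_of_real (d i)) * mat_adjoint V" by blast
  let ?D = "mat_diag n (\<lambda>i. complex_of_real (d i))"
  let ?E = "mat 1 1 (\<lambda>_. e)"
  let ?blk = "\<lambda>X Y. four_block_mat X (0\<^sub>m 1 n) (0\<^sub>m n 1) (Y :: complex mat)"
  have C_blk: "C = ?blk ?E B"
    using C by (intro eq_matI) (auto simp: B_def Ci0 C0i)
  \<comment> \<open>The new eigenvalue goes in front of those of the smaller block, and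
    \<open>V\<close> is extended by the identity on the first coordinate.\<close>
  define d' where "d' = case_nat (Re e) d"
  define V' where "V' = ?blk (1\<^sub>m 1) V"
  let ?D' = "mat_diag ?N (\<lambda>i. complex_of_real (d' i))"
  have D': "?D' = ?blk ?E ?D"
    by (intro eq_matI) (auto simp: mat_diag_def d'_def e split: nat.split)
  have blk_mult: "?blk X Y * ?blk X' Y' = ?blk (X * X') (Y * Y')"
    if "X \<in> carrier_mat 1 1" "X' \<in> carrier_mat 1 1" "Y \<in> carrier_mat n n" "Y' \<in> carrier_mat n n"
    for X X' Y Y'
    using that by (subst mult_four_block_mat[of _ 1 1 _ n _ n _ _ 1 _ n]) auto
  have V': "V' \<in> carrier_mat ?N ?N" unfolding V'_def using V by auto
  have adjV': "mat_adjoint V' = ?blk (1\<^sub>m 1) (mat_adjoint V)"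
    unfolding V'_def using V by (simp add: mat_adjoint_four_block_diag)
  note blk_car = one_carrier_mat mat_carrier V mat_diag_dim mat_adjoint_carrier[OF V]
    mult_carrier_mat[OF V mat_diag_dim] mult_carrier_mat[OF one_carrier_mat mat_carrier]
  have "V' * ?D' * mat_adjoint V' = ?blk (1\<^sub>m 1 * ?E * 1\<^sub>m 1) (V * ?D * mat_adjoint V)"
    unfolding D' adjV' unfolding V'_def by (simp only: blk_mult blk_car)
  also have "1\<^sub>m 1 * ?E * 1\<^sub>m 1 = ?E"
    by (simp only: left_mult_one_mat[OF mat_carrier] right_mult_one_mat[OF mat_carrier])
  finally have C_dec: "C = V' * ?D' * mat_adjoint V'" unfolding C_blk BV by (rule sym)
  have "V' * mat_adjoint V' = ?blk (1\<^sub>m 1 * 1\<^sub>m 1) (1\<^sub>m n)"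
    unfolding adjV' unfolding V'_def by (simp only: blk_mult blk_car VV)
  also have "\<dots> = 1\<^sub>m ?N" by (intro eq_matI) auto
  finally have V'V': "V' * mat_adjoint V' = 1\<^sub>m ?N" .
  define U where "U = W * V'"
  have U: "U \<in> carrier_mat ?N ?N" using W V' by (simp add: U_def)
  have adjU: "mat_adjoint U = mat_adjoint V' * mat_adjoint W"
    unfolding U_def by (rule mat_adjoint_mult[OF W V'])
  note assoc = assoc_mult_mat[of _ ?N ?N _ ?N _ ?N] mult_carrier_mat[of _ ?N ?N _ ?N]
  note V'' = mat_adjoint_carrier[OF V']
  have "U * mat_adjoint U = W * (V' * mat_adjoint V') * mat_adjoint W"
    unfolding adjU unfolding U_def using W V' W' V'' by (simp add: assoc)
  then have UU: "U * mat_adjoint U = 1\<^sub>m ?N" using V'V' W WW' by simp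
  have "A = W * mat_adjoint W * A * (W * mat_adjoint W)" using WW' A by simp
  also have "\<dots> = W * C * mat_adjoint W"
    unfolding C_def using W W' A by (simp add: assoc)
  also have "\<dots> = U * ?D' * mat_adjoint U"
    unfolding C_dec adjU unfolding U_def using W V' W' V'' by (simp add: assoc)
  finally show ?case using U UU by blast
qed

section \<open>A rank bound by determinants\<close>

lemma det_mat_diag_nonzero:
  fixes f :: "nat \<Rightarrow> 'a :: idom"
  assumes "\<And>a. a < k \<Longrightarrow> f a \<noteq> 0"
  shows "det (mat_diag k f) \<noteq> 0"
proof -
  have "upper_triangular (mat_diag k f)" by (auto simp: mat_diag_def)
  then have "det (mat_diag k f) = prod_list (diag_mat (mat_diag k f))"
    by (rule det_upper_triangular) (rule mat_diag_dim)
  then show ?thesis using assms by (auto simp: prod_list_zero_iff diag_mat_def mat_diag_def)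
qed

lemma det_zero_row:
  fixes Q :: "'a :: comm_ring_1 mat"
  assumes "r < k" "Q \<in> carrier_mat k k" "\<And>j. j < k \<Longrightarrow> Q $$ (r, j) = 0"
  shows "det Q = 0"
proof -
  have "Q = mat\<^sub>r k k (\<lambda>i. if i = r then 0\<^sub>v k else row Q i)"
    using assms by (intro eq_matI) auto
  moreover have "det (mat\<^sub>r k k (\<lambda>i. if i = r then 0\<^sub>v k else row Q i)) = 0"
    using assms by (intro det_row_0) auto
  ultimately show ?thesis by (rule ssubst)
qed

text \<open>This plays the part of the rank inequality for a product: an invertible diagonal matrix
  indexed by \<open>K\<close> cannot factor through fewer than \<open>card K\<close>
  dimensions.\<close>

lemma card_nonzero_diag_le_inner_dim:
  fixes d :: "nat \<Rightarrow> 'a :: idom"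
  assumes K: "finite K" and nz: "\<And>i. i \<in> K \<Longrightarrow> d i \<noteq> 0"
    and pq: "\<And>i j. i \<in> K \<Longrightarrow> j \<in> K \<Longrightarrow> (\<Sum>t < r. p i t * q t j) = (if i = j then d i else 0)"
  shows "card K \<le> r"
proof (rule ccontr)
  assume "\<not> card K \<le> r"
  define k where "k = card K"
  have r: "r < k" using \<open>\<not> card K \<le> r\<close> by (simp add: k_def)
  obtain e where e: "bij_betw e {0..<k} K"
    using ex_bij_betw_nat_finite[OF K] by (auto simp: k_def)
  have eK: "e a \<in> K" if "a < k" for a using e that by (auto simp: bij_betw_def)
  have e_eq: "e a = e b \<longleftrightarrow> a = b" if "a < k" "b < k" for a b
    using e that by (auto simp: bij_betw_def inj_on_def)
  \<comment> \<open>Pad both factors with zeros to square matrices; the padding makes them singular.\<close>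
  define P where "P = mat k k (\<lambda>(a, t). if t < r then p (e a) t else 0)"
  define Q where "Q = mat k k (\<lambda>(t, b). if t < r then q t (e b) else 0)"
  have PQ: "P \<in> carrier_mat k k" "Q \<in> carrier_mat k k" by (auto simp: P_def Q_def)
  have "P * Q = mat_diag k (\<lambda>a. d (e a))"
  proof (rule eq_matI)
    fix a b assume "a < dim_row (mat_diag k (\<lambda>a. d (e a)))" "b < dim_col (mat_diag k (\<lambda>a. d (e a)))"
    then have ab: "a < k" "b < k" by (auto simp: mat_diag_def)
    have "(P * Q) $$ (a, b) = (\<Sum>t = 0..<k. if t < r then p (e a) t * q t (e b) else 0)"
      using ab by (auto simp: P_def Q_def scalar_prod_def intro!: sum.cong)
    also have "\<dots> = (\<Sum>t < r. p (e a) t * q t (e b))"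
      using r by (intro sum.mono_neutral_cong_right) auto
    finally show "(P * Q) $$ (a, b) = mat_diag k (\<lambda>a. d (e a)) $$ (a, b)"
      using ab by (auto simp: pq eK e_eq mat_diag_def)
  qed (auto simp: P_def Q_def mat_diag_def)
  moreover have "det (mat_diag k (\<lambda>a. d (e a))) \<noteq> 0"
    using nz eK by (intro det_mat_diag_nonzero) auto
  moreover have "det Q = 0"
    using r PQ(2) by (intro det_zero_row[of r k]) (auto simp: Q_def)
  ultimately show False using det_mult[OF PQ] by (metis mult_zero_right)
qed

section \<open>Entropy of a probability vector and of a density matrix\<close>

text \<open>Gibbs' inequality against the uniform distribution on \<open>r\<close> outcomes: use ln
  x \<le> x - 1 at x = 1 / (r d_i), weight by d_i and sum. What remains on the right is
  \<open>card K\<close> / r - 1, which is at most 0.\<close>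

lemma entropy_le_ln_card:
  fixes d :: "'a \<Rightarrow> real"
  assumes K: "finite K" and pos: "\<And>i. i \<in> K \<Longrightarrow> d i > 0"
    and sum1: "sum d K = 1" and card: "card K \<le> r"
  shows "- (\<Sum>i\<in>K. d i * ln (d i)) \<le> ln (real r)"
proof -
  have "K \<noteq> {}" using sum1 by auto
  then have r: "r > 0" using card K by (metis card_gt_0_iff less_le_trans)
  have "- (d i * ln (d i)) - d i * ln (real r) \<le> 1 / real r - d i" if "i \<in> K" for i
  proof -
    have "ln (1 / (real r * d i)) \<le> 1 / (real r * d i) - 1"
      using pos[OF that] r by (intro ln_le_minus_one) auto
    then have "d i * ln (1 / (real r * d i)) \<le> d i * (1 / (real r * d i) - 1)"
      using pos[OF that] by (intro mult_left_mono) auto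
    then show ?thesis using pos[OF that] r by (simp add: ln_div ln_mult algebra_simps)
  qed
  then have "(\<Sum>i\<in>K. - (d i * ln (d i)) - d i * ln (real r)) \<le> (\<Sum>i\<in>K. 1 / real r - d i)"
    by (rule sum_mono)
  then have "- (\<Sum>i\<in>K. d i * ln (d i)) - ln (real r) \<le> real (card K) / real r - 1"
    using sum1 by (simp add: sum_subtractf sum_negf flip: sum_distrib_right)
  moreover have "real (card K) / real r \<le> 1" using card r by simp
  ultimately show ?thesis by linarith
qed

lemma mat_trace_mult_commute:
  fixes A B :: "'a :: comm_semiring_0 mat"
  assumes "A \<in> carrier_mat n m" "B \<in> carrier_mat m n"
  shows "mat_trace (A * B) = mat_trace (B * A)"
proof -
  have "mat_trace (A * B) = (\<Sum>i = 0..<n. \<Sum>j = 0..<m. A $$ (i, j) * B $$ (j, i))"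
    using assms by (simp add: mat_trace_def diag_mat_def scalar_prod_def sum_list_distinct_conv_sum_set)
  also have "\<dots> = (\<Sum>j = 0..<m. \<Sum>i = 0..<n. B $$ (j, i) * A $$ (i, j))"
    by (subst sum.swap) (simp add: mult.commute)
  also have "\<dots> = mat_trace (B * A)"
    using assms by (simp add: mat_trace_def diag_mat_def scalar_prod_def sum_list_distinct_conv_sum_set)
  finally show ?thesis .
qed

lemma mat_trace_mat_diag: "mat_trace (mat_diag n f) = (\<Sum>i < n. f i)"
  by (simp add: mat_trace_def mat_diag_def diag_mat_def sum_list_distinct_conv_sum_set lessThan_atLeast0)

text \<open>In an eigenbasis of \<open>\<rho>\<close>, the nonzero eigenvalues form an invertible
  diagonal matrix that factors through \<open>r\<close> dimensions, so there are at most
  \<open>r\<close> of them. They are positive and sum to the trace 1, so the bound for probability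
  vectors applies.\<close>

lemma von_neumann_entropy_le_ln_inner_dim:
  fixes F G :: "complex mat"
  assumes F: "F \<in> carrier_mat n r" and G: "G \<in> carrier_mat r m"
    and \<rho>: "\<rho> = (F * G) * mat_adjoint (F * G)" and tr: "mat_trace \<rho> = 1"
  shows "von_neumann_entropy \<rho> \<le> ln (real r)"
proof -
  define M where "M = F * G"
  have M: "M \<in> carrier_mat n m" using F G by (simp add: M_def)
  note M' = mat_adjoint_carrier[OF M]
  have \<rho>M: "\<rho> = M * mat_adjoint M" by (simp add: \<rho> M_def)
  have \<rho>_car: "\<rho> \<in> carrier_mat n n" using M M' by (simp add: \<rho>M)
  have \<rho>_adj: "mat_adjoint \<rho> = \<rho>" by (simp add: \<rho>M mat_adjoint_mult[OF M M'])
  let ?dg = "\<lambda>d :: nat \<Rightarrow> real. mat_diag n (\<lambda>i. complex_of_real (d i))"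
  \<comment> \<open>\<open>?P\<close> is the predicate under the choice operator in
    \<open>hermitian_fun\<close>. The spectral theorem gives one witness, so the chosen matrix
    satisfies \<open>?P\<close>; the \<open>U\<close> and \<open>d\<close> obtained from it
    diagonalize \<open>\<rho>\<close> and its logarithm simultaneously.\<close>
  let ?P = "\<lambda>B. \<exists>U (d :: nat \<Rightarrow> real). U \<in> carrier_mat n n \<and> U * mat_adjoint U = 1\<^sub>m n \<and>
     \<rho> = U * ?dg d * mat_adjoint U \<and> B = U * ?dg (\<lambda>i. ln (d i)) * mat_adjoint U"
  obtain U\<^sub>0 d\<^sub>0 where "U\<^sub>0 \<in> carrier_mat n n" "U\<^sub>0 * mat_adjoint U\<^sub>0 = 1\<^sub>m n"
    "\<rho> = U\<^sub>0 * ?dg d\<^sub>0 * mat_adjoint U\<^sub>0"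
    using hermitian_spectral_decomposition[OF \<rho>_car \<rho>_adj] by blast
  then have "?P (U\<^sub>0 * ?dg (\<lambda>i. ln (d\<^sub>0 i)) * mat_adjoint U\<^sub>0)"
    by (intro exI[of _ U\<^sub>0] exI[of _ d\<^sub>0] conjI refl)
  then have "?P (SOME B. ?P B)" by (rule someI)
  moreover have "dim_row \<rho> = n" using \<rho>_car by simp
  then have "hermitian_fun ln \<rho> = (SOME B. ?P B)" by (simp only: hermitian_fun_def)
  ultimately have "?P (hermitian_fun ln \<rho>)" by (simp only:)
  then obtain U d where U: "U \<in> carrier_mat n n" and UU: "U * mat_adjoint U = 1\<^sub>m n"
    and dec: "\<rho> = U * ?dg d * mat_adjoint U"
    and ln_dec: "hermitian_fun ln \<rho> = U * ?dg (\<lambda>i. ln (d i)) * mat_adjoint U" by blast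
  note U' = mat_adjoint_carrier[OF U]
  have U'U: "mat_adjoint U * U = 1\<^sub>m n" using mat_mult_left_right_inverse[OF U U' UU] .
  note assoc = assoc_mult_mat[of _ n n _ n _ n] mult_carrier_mat[of _ n n _ n]
  have trU: "mat_trace (U * ?dg f * mat_adjoint U) = complex_of_real (\<Sum>i < n. f i)" for f
  proof -
    have "mat_trace (U * ?dg f * mat_adjoint U) = mat_trace (mat_adjoint U * (U * ?dg f))"
      by (rule mat_trace_mult_commute[OF mult_carrier_mat[OF U mat_diag_dim] U'])
    also have "mat_adjoint U * (U * ?dg f) = (mat_adjoint U * U) * ?dg f"
      using U U' by (simp add: assoc)
    finally show ?thesis by (simp add: U'U left_mult_one_mat[of _ n n] mat_trace_mat_diag)
  qed
  have "\<rho> * hermitian_fun ln \<rho> = U * ?dg d * (mat_adjoint U * U) * ?dg (\<lambda>i. ln (d i)) * mat_adjoint U"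
    unfolding ln_dec by (subst dec) (use U U' in \<open>simp add: assoc\<close>)
  also have "\<dots> = U * (?dg d * ?dg (\<lambda>i. ln (d i))) * mat_adjoint U"
    using U U' unfolding U'U by (simp add: assoc right_mult_one_mat[of _ n n] del: mat_diag_diag)
  also have "\<dots> = U * ?dg (\<lambda>i. d i * ln (d i)) * mat_adjoint U"
    by simp
  finally have ent: "von_neumann_entropy \<rho> = - (\<Sum>i < n. d i * ln (d i))"
    by (simp add: von_neumann_entropy_def trU del: of_real_mult of_real_sum)
  have sum1: "(\<Sum>i < n. d i) = 1"
    using tr trU[of d] dec by (metis of_real_eq_1_iff)
  have "mat_adjoint U * \<rho> * U = (mat_adjoint U * U) * ?dg d * (mat_adjoint U * U)"
    by (subst dec) (use U U' in \<open>simp add: assoc\<close>)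
  then have diag: "mat_adjoint U * \<rho> * U = ?dg d"
    by (simp add: U'U left_mult_one_mat[of _ n n] right_mult_one_mat[of _ n n])
  \<comment> \<open>Row \<open>i\<close> of \<open>T\<close> has squared norm \<open>d i\<close>,
    which shows that the eigenvalues are nonnegative.\<close>
  define T where "T = mat_adjoint U * M"
  have T: "T \<in> carrier_mat n m" using U' M by (simp add: T_def)
  have adjT: "mat_adjoint T = mat_adjoint M * U"
    using mat_adjoint_mult[OF U' M] by (simp add: T_def)
  have TT: "T * mat_adjoint T = ?dg d"
    unfolding adjT diag[symmetric] unfolding T_def \<rho>M
    using U U' M M' by (simp add: assoc assoc_mult_mat[of _ n m _ n _ n] assoc_mult_mat[of _ n n _ m _ n]
        mult_carrier_mat[of _ n m _ n] mult_carrier_mat[of _ m n _ n])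
  have nonneg: "d i \<ge> 0" if i: "i < n" for i
  proof -
    have "complex_of_real (d i) = (T * mat_adjoint T) $$ (i, i)"
      unfolding TT using i by (simp add: mat_diag_def)
    also have "\<dots> = (\<Sum>j = 0..<m. T $$ (i, j) * cnj (T $$ (i, j)))"
      using T i by (simp add: mat_adjoint_eq scalar_prod_def)
    also have "\<dots> = complex_of_real (\<Sum>j = 0..<m. (cmod (T $$ (i, j)))\<^sup>2)"
      by (simp only: of_real_sum complex_norm_square)
    finally have "d i = (\<Sum>j = 0..<m. (cmod (T $$ (i, j)))\<^sup>2)"
      using of_real_eq_iff by blast
    then show ?thesis by (simp add: sum_nonneg)
  qed
  define K where "K = {i. i < n \<and> d i \<noteq> 0}"
  \<comment> \<open>The diagonal matrix of eigenvalues is \<open>T * mat_adjoint T\<close>;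
    regrouped as \<open>P * Q\<close>, it has inner dimension \<open>r\<close>.\<close>
  define P where "P = mat_adjoint U * F"
  define Q where "Q = G * mat_adjoint T"
  have P: "P \<in> carrier_mat n r" using U' F by (simp add: P_def)
  have Q: "Q \<in> carrier_mat r n" using G T by (simp add: Q_def)
  have "T = P * G" unfolding T_def P_def M_def using U' F G by simp
  then have PQ: "P * Q = ?dg d"
    using TT P G mat_adjoint_carrier[OF T] unfolding Q_def by (simp add: assoc_mult_mat[of _ n r _ m _ n])
  have "card K \<le> r"
  proof (rule card_nonzero_diag_le_inner_dim)
    show "(\<Sum>t < r. P $$ (i, t) * Q $$ (t, j)) = (if i = j then complex_of_real (d i) else 0)"
      if "i \<in> K" "j \<in> K" for i j
      using arg_cong[OF PQ, of "\<lambda>X. X $$ (i, j)"] that P Q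
      by (auto simp: K_def scalar_prod_def mat_diag_def lessThan_atLeast0)
  qed (auto simp: K_def)
  moreover have "(\<Sum>i\<in>K. d i) = 1"
    using sum1 by (subst sum.mono_neutral_left[of "{..<n}"]) (auto simp: K_def)
  \<comment> \<open>Outside \<open>K\<close> the factor \<open>d i\<close> is zero, so the kernel of
    \<open>\<rho>\<close> drops out.\<close>
  moreover have "(\<Sum>i < n. d i * ln (d i)) = (\<Sum>i\<in>K. d i * ln (d i))"
    by (intro sum.mono_neutral_right) (auto simp: K_def)
  moreover have "d i > 0" if "i \<in> K" for i
    using nonneg[of i] that by (auto simp: K_def)
  ultimately show ?thesis
    unfolding ent using entropy_le_ln_card[of K d r] by (auto simp: K_def)
qed

section \<open>Tower states across a cut\<close>

text \<open>A one-site operator in the left region treats \<open>b\<close> as a spectator and is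
  linear in the left factors. The assumption covers all lists of the given lengths, because the
  entry \<open>m - 1\<close> read by \<open>spin_raise\<close> may leave the range of
  \<open>configs\<close>.\<close>

lemma spin_raise_append_left:
  assumes \<psi>: "\<And>a b. length a = l \<Longrightarrow> length b = l' \<Longrightarrow> \<psi> (a @ b) = (\<Sum>t\<in>T. \<phi> t a * \<chi> t b)"
    and j: "1 \<le> j" "j \<le> l" and "length a = l" "length b = l'"
  shows "(spin_raise S j ^^ n) \<psi> (a @ b) = (\<Sum>t\<in>T. (spin_raise S j ^^ n) (\<phi> t) a * \<chi> t b)"
  using assms(4,5)
proof (induction n arbitrary: a b)
  case 0
  then show ?case by (simp add: \<psi>)
next
  case (Suc n)
  define \<Psi> where "\<Psi> = (spin_raise S j ^^ n) \<psi>"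
  define \<Phi> where "\<Phi> t = (spin_raise S j ^^ n) (\<phi> t)" for t
  have IH: "\<Psi> (a @ b) = (\<Sum>t\<in>T. \<Phi> t a * \<chi> t b)" if "length a = l" "length b = l'" for a b
    unfolding \<Psi>_def \<Phi>_def using Suc.IH that by blast
  have "j - 1 < length a" using j Suc.prems by simp
  then have "spin_raise S j \<Psi> (a @ b) = (\<Sum>t\<in>T. spin_raise S j (\<Phi> t) a * \<chi> t b)"
    using Suc.prems
    by (simp add: spin_raise_def Let_def nth_append list_update_append IH sum_distrib_left mult.assoc)
  then show ?case by (simp add: \<Psi>_def \<Phi>_def)
qed

lemma spin_raise_append_right:
  assumes \<psi>: "\<And>a b. length a = l \<Longrightarrow> length b = l' \<Longrightarrow> \<psi> (a @ b) = (\<Sum>t\<in>T. \<phi> t a * \<chi> t b)"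
    and j: "1 \<le> j" and "length a = l" "length b = l'"
  shows "(spin_raise S (j + l) ^^ n) \<psi> (a @ b) = (\<Sum>t\<in>T. \<phi> t a * (spin_raise S j ^^ n) (\<chi> t) b)"
  using assms(3,4)
proof (induction n arbitrary: a b)
  case 0
  then show ?case by (simp add: \<psi>)
next
  case (Suc n)
  define \<Psi> where "\<Psi> = (spin_raise S (j + l) ^^ n) \<psi>"
  define X where "X t = (spin_raise S j ^^ n) (\<chi> t)" for t
  have IH: "\<Psi> (a @ b) = (\<Sum>t\<in>T. \<phi> t a * X t b)" if "length a = l" "length b = l'" for a b
    unfolding \<Psi>_def X_def using Suc.IH that by blast
  \<comment> \<open>Site \<open>j + l\<close> of the chain is site \<open>j\<close> of the right
    region, at list position \<open>j - 1\<close> of \<open>b\<close>; \<open>1 \<le> j\<close>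
    keeps the subtraction on naturals exact.\<close>
  have jl: "j + l - 1 = length a + (j - 1)" using j Suc.prems by simp
  have "spin_raise S (j + l) \<Psi> (a @ b) = (\<Sum>t\<in>T. \<phi> t a * spin_raise S j (X t) b)"
    using Suc.prems unfolding spin_raise_def Let_def jl
    by (simp add: nth_append list_update_append IH sum_distrib_left mult.left_commute)
  then show ?case by (simp add: \<Psi>_def X_def)
qed

text \<open>Each summand of the operator acts on one side of the cut only. Renumbering the right
  sites from 1 turns the sign (-1)^(j + l) into (-1)^j times the global factor (-1)^l.\<close>

lemma tower_op_append:
  assumes \<psi>: "\<And>a b. length a = l \<Longrightarrow> length b = l' \<Longrightarrow> \<psi> (a @ b) = (\<Sum>t\<in>T. \<phi> t a * \<chi> t b)"
    and a: "length a = l" and b: "length b = l'"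
  shows "tower_op S (l + l') \<psi> (a @ b)
    = (\<Sum>t\<in>T. tower_op S l (\<phi> t) a * \<chi> t b) + (\<Sum>t\<in>T. \<phi> t a * ((- 1) ^ l * tower_op S l' (\<chi> t) b))"
proof -
  let ?f = "\<lambda>j. (- 1) ^ j * (spin_raise S j ^^ (2 * S)) \<psi> (a @ b)"
  have "tower_op S (l + l') \<psi> (a @ b) = sum ?f {1..l} + sum ?f {1 + l..l' + l}"
    using sum.ub_add_nat[of 1 l ?f l'] by (simp add: tower_op_def add.commute)
  also have "sum ?f {1..l} = (\<Sum>j = 1..l. (- 1) ^ j * (\<Sum>t\<in>T. (spin_raise S j ^^ (2 * S)) (\<phi> t) a * \<chi> t b))"
    by (intro sum.cong refl) (simp add: spin_raise_append_left[of l l' \<psi>, OF \<psi> _ _ a b])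
  also have "\<dots> = (\<Sum>t\<in>T. tower_op S l (\<phi> t) a * \<chi> t b)"
    by (simp add: tower_op_def sum_distrib_left sum_distrib_right mult.assoc sum.swap[of _ T])
  also have "sum ?f {1 + l..l' + l} = (\<Sum>j = 1..l'. ?f (j + l))"
    by (rule sum.shift_bounds_cl_nat_ivl)
  also have "\<dots> = (\<Sum>j = 1..l'. (- 1) ^ (j + l) * (\<Sum>t\<in>T. \<phi> t a * (spin_raise S j ^^ (2 * S)) (\<chi> t) b))"
    by (intro sum.cong refl) (simp add: spin_raise_append_right[of l l' \<psi>, OF \<psi> _ a b])
  also have "\<dots> = (\<Sum>t\<in>T. \<phi> t a * ((- 1) ^ l * tower_op S l' (\<chi> t) b))"
    by (simp add: tower_op_def sum_distrib_left sum.swap[of _ T] power_add mult_ac)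
  finally show ?thesis .
qed

section \<open>Schmidt-type decomposition of the tower states\<close>

lemma foldr_mat_mult_append:
  fixes A :: "'b \<Rightarrow> 'a :: comm_ring_1 mat"
  assumes "\<And>m. A m \<in> carrier_mat n n"
  shows "foldr (\<lambda>m X. A m * X) as (1\<^sub>m n) \<in> carrier_mat n n"
    and "foldr (\<lambda>m X. A m * X) (as @ bs) (1\<^sub>m n)
      = foldr (\<lambda>m X. A m * X) as (1\<^sub>m n) * foldr (\<lambda>m X. A m * X) bs (1\<^sub>m n)"
proof -
  show car: "foldr (\<lambda>m X. A m * X) as (1\<^sub>m n) \<in> carrier_mat n n" for as
    by (induction as) (auto intro!: mult_carrier_mat[OF assms])
  show "foldr (\<lambda>m X. A m * X) (as @ bs) (1\<^sub>m n)
      = foldr (\<lambda>m X. A m * X) as (1\<^sub>m n) * foldr (\<lambda>m X. A m * X) bs (1\<^sub>m n)"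
    by (induction as) (use car[of bs] in \<open>auto simp: assoc_mult_mat[OF assms car car]\<close>)
qed

text \<open>The matrix string factors at the cut, and the summation index of the matrix product is
  the spin on the cut bond, which takes \<open>S + 1\<close> values.\<close>

lemma aklt_ground_append:
  fixes S :: nat
  defines "X \<equiv> \<lambda>ms. foldr (\<lambda>m X. aklt_A S m * X) ms (1\<^sub>m (S + 1))"
  shows "aklt_ground S (a @ b) = (\<Sum>i \<le> S. X a $$ (S, i) * X b $$ (i, 0))"
proof -
  have A: "aklt_A S m \<in> carrier_mat (S + 1) (S + 1)" for m
    by (rule carrier_matI) (simp_all add: aklt_A_def aklt_M_def aklt_Theta_def)
  have X: "X as \<in> carrier_mat (S + 1) (S + 1)" and X_append: "X (as @ bs) = X as * X bs" for as bs
    unfolding X_def by (rule foldr_mat_mult_append[OF A])+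
  have "aklt_ground S (a @ b) = (X a * X b) $$ (S, 0)"
    unfolding X_append[symmetric] by (simp only: aklt_ground_def X_def)
  also have "\<dots> = (\<Sum>i \<in> {0..<S + 1}. X a $$ (S, i) * X b $$ (i, 0))"
    using X[of a] X[of b] by (subst index_mult_mat) (auto simp: scalar_prod_def intro!: sum.cong)
  also have "{0..<S + 1} = {..S}" by auto
  finally show ?thesis .
qed

text \<open>Bookkeeping for one more application of the tower operator: its left half raises the
  power \<open>k\<close>, its right half keeps it. Both contributions are collected by the left
  factor \<open>f k\<close>.\<close>

lemma sum_atMost_shift_add:
  fixes f g h :: "nat \<Rightarrow> 'a :: comm_ring_1"
  shows "(\<Sum>k \<le> N. f (Suc k) * g k) + (\<Sum>k \<le> N. f k * h k)
    = (\<Sum>k \<le> Suc N. f k * ((case k of 0 \<Rightarrow> 0 | Suc k' \<Rightarrow> g k') + (if k \<le> N then h k else 0)))"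
proof -
  have "(\<Sum>k \<le> Suc N. f k * (case k of 0 \<Rightarrow> 0 | Suc k' \<Rightarrow> g k')) = (\<Sum>k \<le> N. f (Suc k) * g k)"
    by (subst sum.atMost_Suc_shift) simp
  moreover have "(\<Sum>k \<le> Suc N. f k * (if k \<le> N then h k else 0)) = (\<Sum>k \<le> N. f k * h k)"
    by simp
  ultimately show ?thesis by (simp only: distrib_left sum.distrib)
qed

lemma tower_state_append:
  "\<exists>\<phi> \<chi>. \<forall>a b. length a = l \<longrightarrow> length b = l' \<longrightarrow>
     tower_state S (l + l') N (a @ b) = (\<Sum>(i, k) \<in> {..S} \<times> {..N}. \<phi> i k a * \<chi> i k b)"
proof -
  define X where "X = (\<lambda>ms. foldr (\<lambda>m X. aklt_A S m * X) ms (1\<^sub>m (S + 1)))"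
  define \<phi> where "\<phi> i k = (tower_op S l ^^ k) (\<lambda>a. X a $$ (S, i))" for i k
  \<comment> \<open>The left factors are fixed before the induction and do not depend on
    \<open>N\<close>. The right factors stay existential and absorb all signs and
    multiplicities.\<close>
  have "\<exists>\<chi>. \<forall>a b. length a = l \<longrightarrow> length b = l' \<longrightarrow>
     tower_state S (l + l') N (a @ b) = (\<Sum>(i, k) \<in> {..S} \<times> {..N}. \<phi> i k a * \<chi> i k b)"
  proof (induction N)
    case 0
    show ?case
      by (rule exI[of _ "\<lambda>i k b. X b $$ (i, 0)"])
        (simp add: tower_state_def aklt_ground_append X_def \<phi>_def flip: sum.cartesian_product)
  next
    case (Suc N)
    then obtain \<chi> where \<chi>: "\<And>a b. length a = l \<Longrightarrow> length b = l' \<Longrightarrow>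
      tower_state S (l + l') N (a @ b)
        = (\<Sum>t \<in> {..S} \<times> {..N}. \<phi> (fst t) (snd t) a * \<chi> (fst t) (snd t) b)"
      by (auto simp: case_prod_unfold)
    define \<xi> where "\<xi> i k b = (- 1) ^ l * tower_op S l' (\<chi> i k) b" for i k b
    \<comment> \<open>Power \<open>k\<close> receives \<open>\<chi>\<close> from power
      \<open>k - 1\<close> through the left half and \<open>\<xi>\<close> from power
      \<open>k\<close> through the right half. At \<open>k = 0\<close> the first source is absent,
      at \<open>k = Suc N\<close> the second.\<close>
    define \<chi>' where "\<chi>' i k b = (case k of 0 \<Rightarrow> 0 | Suc k' \<Rightarrow> \<chi> i k' b)
      + (if k \<le> N then \<xi> i k b else 0)" for i k b
    have "tower_state S (l + l') (Suc N) (a @ b) = (\<Sum>(i, k) \<in> {..S} \<times> {..Suc N}. \<phi> i k a * \<chi>' i k b)"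
      if "length a = l" "length b = l'" for a b
    proof -
      have "tower_state S (l + l') (Suc N) (a @ b)
        = tower_op S (l + l') (tower_state S (l + l') N) (a @ b)"
        by (simp add: tower_state_def)
      also have "\<dots> = (\<Sum>t \<in> {..S} \<times> {..N}. \<phi> (fst t) (Suc (snd t)) a * \<chi> (fst t) (snd t) b)
          + (\<Sum>t \<in> {..S} \<times> {..N}. \<phi> (fst t) (snd t) a * \<xi> (fst t) (snd t) b)"
        using tower_op_append[where \<psi> = "tower_state S (l + l') N" and T = "{..S} \<times> {..N}"
            and \<phi> = "\<lambda>t. \<phi> (fst t) (snd t)" and \<chi> = "\<lambda>t. \<chi> (fst t) (snd t)", OF \<chi> that]
        by (simp add: \<phi>_def \<xi>_def)
      also have "\<dots> = (\<Sum>i \<le> S. (\<Sum>k \<le> N. \<phi> i (Suc k) a * \<chi> i k b) + (\<Sum>k \<le> N. \<phi> i k a * \<xi> i k b))"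
        by (simp add: sum.distrib sum.cartesian_product case_prod_unfold)
      also have "\<dots> = (\<Sum>i \<le> S. \<Sum>k \<le> Suc N. \<phi> i k a * \<chi>' i k b)"
        unfolding \<chi>'_def
        using sum_atMost_shift_add[where f = "\<lambda>k. \<phi> i k a" and g = "\<lambda>k. \<chi> i k b"
            and h = "\<lambda>k. \<xi> i k b" for i] by (intro sum.cong refl)
      finally show ?thesis by (simp only: sum.cartesian_product)
    qed
    then show ?case by blast
  qed
  then show ?thesis by blast
qed

section \<open>The reduced density matrix of a decomposed state\<close>

lemma finite_configs: "finite (configs S L)"
  by (metis List.finite_set set_config_list)

lemma sum_configs_append:
  fixes f :: "int list \<Rightarrow> 'a :: comm_monoid_add"
  shows "(\<Sum>ms \<in> configs S (l + l'). f ms) = (\<Sum>a \<in> configs S l. \<Sum>b \<in> configs S l'. f (a @ b))"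
proof -
  have "(\<Sum>ms \<in> configs S (l + l'). f ms) = (\<Sum>(a, b) \<in> configs S l \<times> configs S l'. f (a @ b))"
    by (rule sum.reindex_bij_witness[of _ "\<lambda>(a, b). a @ b" "\<lambda>ms. (take l ms, drop l ms)"])
      (auto simp: configs_def dest: in_set_takeD in_set_dropD)
  then show ?thesis by (simp add: sum.cartesian_product)
qed

lemma norm_sq_pos:
  assumes "ms \<in> configs S L" "\<psi> ms \<noteq> 0"
  shows "norm_sq S L \<psi> > 0"
  unfolding norm_sq_def using assms by (intro sum_pos2[of _ ms] finite_configs) auto

text \<open>Arrange the normalized amplitudes in a matrix \<open>M\<close>, with left configurations
  as rows and right ones as columns. Then the reduced density matrix is
  \<open>M * mat_adjoint M\<close>, and a sum of \<open>r\<close> products is a factorization of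
  \<open>M\<close> through \<open>r\<close> dimensions.\<close>

lemma reduced_density_entropy_le:
  assumes \<psi>: "\<And>a b. length a = l \<Longrightarrow> length b = l' \<Longrightarrow> \<psi> (a @ b) = (\<Sum>t < r. \<phi> t a * \<chi> t b)"
    and pos: "norm_sq S (l + l') \<psi> > 0"
  shows "von_neumann_entropy (reduced_density S (l + l') l \<psi>) \<le> ln (real r)"
proof -
  let ?cs = "config_list S l" and ?ds = "config_list S l'"
  define Z where "Z = norm_sq S (l + l') \<psi>"
  define s where "s = sqrt Z"
  have s: "complex_of_real s * complex_of_real s = complex_of_real Z"
    using pos by (simp add: s_def Z_def flip: of_real_mult)
  define n m where "n = length ?cs" and "m = length ?ds"
  have cs: "length (?cs ! i) = l" if "i < n" for i
    using that nth_mem[of i ?cs] by (simp add: n_def set_config_list configs_def)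
  have ds: "length (?ds ! i) = l'" if "i < m" for i
    using that nth_mem[of i ?ds] by (simp add: m_def set_config_list configs_def)
  \<comment> \<open>\<open>config_list\<close> enumerates \<open>configs\<close> without repetition,
    so sums over matrix indices are sums over configurations.\<close>
  have nth_sum: "(\<Sum>i < length (config_list S k). g (config_list S k ! i)) = (\<Sum>ms \<in> configs S k. g ms)"
    for k and g :: "int list \<Rightarrow> complex"
    using sum.reindex_bij_betw[OF bij_betw_nth[OF distinct_config_list refl refl], of g S k]
    by (simp add: set_config_list)
  define F where "F = mat n r (\<lambda>(i, t). \<phi> t (?cs ! i))"
  \<comment> \<open>The whole normalization is put into the right factor, so that
    \<open>F * G\<close> is the normalized amplitude matrix.\<close>
  define G where "G = mat r m (\<lambda>(t, j). \<chi> t (?ds ! j) / complex_of_real s)"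
  define M where "M = mat n m (\<lambda>(i, j). \<psi> (?cs ! i @ ?ds ! j) / complex_of_real s)"
  have FG: "F * G = M"
    by (intro eq_matI)
      (auto simp: F_def G_def M_def scalar_prod_def \<psi> cs ds lessThan_atLeast0 sum_divide_distrib)
  have \<rho>: "reduced_density S (l + l') l \<psi> = M * mat_adjoint M"
  proof (rule eq_matI)
    fix i k assume "i < dim_row (M * mat_adjoint M)" "k < dim_col (M * mat_adjoint M)"
    then have ik: "i < n" "k < n" by (auto simp: M_def mat_adjoint_eq)
    have "(M * mat_adjoint M) $$ (i, k)
      = (\<Sum>j < m. \<psi> (?cs ! i @ ?ds ! j) * cnj (\<psi> (?cs ! k @ ?ds ! j))) / complex_of_real Z"
      using ik by (simp add: M_def mat_adjoint_eq scalar_prod_def lessThan_atLeast0 sum_divide_distrib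
          flip: s)
    then show "reduced_density S (l + l') l \<psi> $$ (i, k) = (M * mat_adjoint M) $$ (i, k)"
      using ik nth_sum[of "\<lambda>ms. \<psi> (?cs ! i @ ms) * cnj (\<psi> (?cs ! k @ ms))" l']
      by (simp add: reduced_density_def Let_def n_def m_def Z_def)
  qed (auto simp: reduced_density_def Let_def M_def mat_adjoint_eq n_def)
  have "mat_trace (reduced_density S (l + l') l \<psi>)
    = (\<Sum>i < n. (\<Sum>ms \<in> configs S l'. \<psi> (?cs ! i @ ms) * cnj (\<psi> (?cs ! i @ ms))) / complex_of_real Z)"
    by (simp add: mat_trace_def diag_mat_def reduced_density_def Let_def n_def Z_def
        sum_list_distinct_conv_sum_set lessThan_atLeast0)
  also have "\<dots> = (\<Sum>a \<in> configs S l. \<Sum>ms \<in> configs S l'. \<psi> (a @ ms) * cnj (\<psi> (a @ ms)))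
      / complex_of_real Z"
    using nth_sum[of "\<lambda>a. \<Sum>ms \<in> configs S l'. \<psi> (a @ ms) * cnj (\<psi> (a @ ms))" l]
    by (simp add: n_def flip: sum_divide_distrib)
  also have "\<dots> = (\<Sum>ms \<in> configs S (l + l'). \<psi> ms * cnj (\<psi> ms)) / complex_of_real Z"
    by (simp only: sum_configs_append)
  also have "(\<Sum>ms \<in> configs S (l + l'). \<psi> ms * cnj (\<psi> ms)) = complex_of_real Z"
    by (simp only: Z_def norm_sq_def of_real_sum complex_norm_square)
  also have "complex_of_real Z / complex_of_real Z = 1"
    using pos by (simp add: Z_def)
  finally have "mat_trace (reduced_density S (l + l') l \<psi>) = 1" .
  then show ?thesis
    using von_neumann_entropy_le_ln_inner_dim[of F n r G m] \<rho> FG by (simp add: F_def G_def)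
qed

theorem mainTheorem2:
  fixes S L N l :: nat
  assumes "S \<ge> 1" and "L \<ge> 2"
    and "\<exists>ms \<in> configs S L. tower_state S L N ms \<noteq> 0"
    and "1 \<le> l" and "l < L"
  shows "von_neumann_entropy (reduced_density S L l (tower_state S L N))
           \<le> ln ((real S + 1) * (real N + 1))"
proof -
  define l' where "l' = L - l"
  have L: "L = l + l'" using assms(5) by (simp add: l'_def)
  define r where "r = (S + 1) * (N + 1)"
  obtain \<phi> \<chi> where dec: "\<And>a b. length a = l \<Longrightarrow> length b = l' \<Longrightarrow>
    tower_state S L N (a @ b) = (\<Sum>(i, k) \<in> {..S} \<times> {..N}. \<phi> i k a * \<chi> i k b)"
    using tower_state_append[of l l' S N] unfolding L by blast
  \<comment> \<open>The pairs (bond index, power of the left operator) are numbered below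
    \<open>r\<close>, as the entropy bound expects a sum over \<open>t < r\<close>.\<close>
  obtain e where e: "bij_betw e {..<r} ({..S} \<times> {..N})"
    using ex_bij_betw_nat_finite[of "{..S} \<times> {..N}"]
    by (auto simp: r_def lessThan_atLeast0 card_cartesian_product)
  have "tower_state S L N (a @ b)
    = (\<Sum>t < r. (case e t of (i, k) \<Rightarrow> \<phi> i k a) * (case e t of (i, k) \<Rightarrow> \<chi> i k b))"
    if "length a = l" "length b = l'" for a b
    unfolding dec[OF that] sum.reindex_bij_betw[OF e, symmetric] by (simp add: case_prod_unfold)
  moreover have "norm_sq S L (tower_state S L N) > 0"
    using assms(3) norm_sq_pos by blast
  ultimately have "von_neumann_entropy (reduced_density S L l (tower_state S L N)) \<le> ln (real r)"
    unfolding L by (intro reduced_density_entropy_le)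
  then show ?thesis by (simp add: r_def algebra_simps)
qed

end
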